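(* Let $s\in\{\mathtt{0},\mathtt{1}\}^{\mathbb{Z}}$ be a balanced sequence and let $u,v\in\mathcal{L}(s)$ be two factors of $s$. If $u<_{radix}v$, then $\mu_q(u)_{12}\prec\mu_q(v)_{12}$, i.e., $\mu_q(v)_{12}-\mu_q(u)_{12}$ is a nonzero polynomial in the indeterminate $q$ with nonnegative integer coefficients.
   Context: A sequence $s\in\{\mathtt{0},\mathtt{1}\}^{\mathbb{Z}}$ has language $\mathcal{L}(s)=\{s_ks_{k+1}\cdots s_{k+n-1}: k\in\mathbb{Z}, n\ge 0\}$ (its set of factors). $s$ is balanced if for every $n\ge1$, every $u,v\in\mathcal{L}(s)$ of length $n$ and every letter $a\in\{\mathtt{0},\mathtt{1}\}$, the numbers of occurrences of $a$ in $u$ and in $v$ differ by at most $1$. $\mu_q:\{\mathtt{0},\mathtt{1}\}^*\to \mathrm{GL}_2(\mathbb{Z}[q^{\pm1}])$ is the monoid homomorphism with $\mu_q(\mathtt{0})=\begin{pmatrix} q+q^2 & 1\\ q & 1\end{pmatrix}$ and $\mu_q(\mathtt{1})=\begin{pmatrix} q+2q^2+q^3+q^4 & 1+q\\ q+q^2 & 1\end{pmatrix}$; $M_{12}$ denotes the entry in row 1, column 2 of a $2\times 2$ matrix $M$. The radix order: $u<_{radix}v$ if $|u|<|v|$, or $|u|=|v|$ and $u<_{lex}v$ (lexicographic order with $\mathtt{0}<\mathtt{1}$). For $f,g\in\mathbb{Z}[q]$, $f\prec g$ means $f\neq g$ and $g-f\in\mathbb{Z}_{\ge0}[q]$. *)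

theory Defs
  imports "HOL-Analysis.Analysis" "HOL-Computational_Algebra.Polynomial"
begin

datatype letter = L0 | L1

definition factor :: "(int \<Rightarrow> letter) \<Rightarrow> int \<Rightarrow> nat \<Rightarrow> letter list" where
  "factor s k n = map (\<lambda>i. s (k + int i)) [0..<n]"

definition language :: "(int \<Rightarrow> letter) \<Rightarrow> letter list set" where
  "language s = {factor s k n | k n. True}"

definition balanced :: "(int \<Rightarrow> letter) \<Rightarrow> bool" where
  "balanced s \<longleftrightarrow>
    (\<forall>n\<ge>1. \<forall>u\<in>language s. \<forall>v\<in>language s. length u = n \<longrightarrow> length v = n \<longrightarrow>
      (\<forall>a. \<bar>int (count_list u a) - int (count_list v a)\<bar> \<le> 1))"

definition radix_less :: "letter list \<Rightarrow> letter list \<Rightarrow> bool" (infix "<\<^sub>r" 50) where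
  "u <\<^sub>r v \<longleftrightarrow> (u, v) \<in> lenlex {(L0, L1)}"

lemma radix_less_iff:
  "u <\<^sub>r v \<longleftrightarrow>
    length u < length v \<or> (length u = length v \<and> (u, v) \<in> lexord {(L0, L1)})"
  by (auto simp: radix_less_def lenlex_conv lexord_lex)

abbreviation qvar :: "int poly" where
  "qvar \<equiv> [:0, 1:]"

text \<open>
  The matrices have entries in \<open>\<int>[q]\<close>, so they are given over \<^typ>\<open>int poly\<close> rather than over
  the Laurent polynomials. By \<open>det_mu_q\<close> below, their determinants are powers of \<open>q\<close>, so they
  are invertible over \<open>\<int>[q, 1/q]\<close>.
\<close>

fun mu_letter :: "letter \<Rightarrow> int poly ^ 2 ^ 2" where
  "mu_letter L0 = vector [vector [qvar + qvar ^ 2, 1],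
                          vector [qvar, 1]]"
| "mu_letter L1 = vector [vector [qvar + 2 * qvar ^ 2 + qvar ^ 3 + qvar ^ 4, 1 + qvar],
                          vector [qvar + qvar ^ 2, 1]]"

primrec mu_q :: "letter list \<Rightarrow> int poly ^ 2 ^ 2" where
  "mu_q [] = mat 1"
| "mu_q (a # w) = mu_letter a ** mu_q w"

lemma mu_q_append: "mu_q (u @ v) = mu_q u ** mu_q v"
  by (induction u) (simp_all add: matrix_mul_assoc)

lemma det_mu_letter:
  "det (mu_letter a) = (case a of L0 \<Rightarrow> qvar ^ 2 | L1 \<Rightarrow> qvar ^ 4)"
  by (cases a) (simp_all add: det_2 numeral_poly one_pCons eval_nat_numeral)

lemma det_mu_q: "det (mu_q w) = qvar ^ (2 * count_list w L0 + 4 * count_list w L1)"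
proof (induction w)
  case (Cons a w)
  then show ?case
    by (cases a) (simp_all only: mu_q.simps det_mul det_mu_letter count_list.simps
      letter.simps letter.distinct if_True if_False power_add [symmetric], simp_all add: ac_simps)
qed simp

definition poly_prec :: "int poly \<Rightarrow> int poly \<Rightarrow> bool" (infix "\<prec>" 50) where
  "f \<prec> g \<longleftrightarrow> f \<noteq> g \<and> (\<forall>i. coeff (g - f) i \<ge> 0)"

end

theory Submission
  imports Defs
begin

text \<open>
  Since \<open>s\<close> is balanced, there is an irrational slope \<open>\<alpha>\<close> in \<open>(0, 1)\<close> such that the number of \<open>1\<close>s
  in every factor of length \<open>n \<le> N\<close> differs from \<open>\<alpha> n\<close> by less than \<open>1\<close>; the words with this
  property are called tight. If \<open>u < v\<close> are tight words of the same length, then the prefix counts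
  of \<open>u\<close> are at most those of \<open>v\<close>, and one can pass from \<open>u\<close> to \<open>v\<close> through tight words by raising
  one prefix count at a time. Such a step replaces \<open>p01y\<close> by \<open>p10y\<close> (or \<open>p0\<close> by \<open>p1\<close>) and changes the
  upper right entry by \<open>(q + q\<^sup>4)\<close> times a determinant which depends only on the reversal of \<open>p\<close>
  and on \<open>y\<close>. Their common prefix \<open>z\<close> contributes a power of \<open>q\<close>, and what remains has nonnegative
  coefficients unless \<open>p\<close> ends in \<open>0\<close> followed by the reversal of \<open>z\<close> and \<open>y\<close> starts with \<open>z1\<close>;
  this is excluded, since \<open>0z\<^sup>R0\<close> and \<open>1z1\<close> are not both tight.

  For different lengths it suffices to compare the largest tight word of length \<open>n\<close> with the
  smallest one of length \<open>n + 1\<close>. These are \<open>1c\<close> and \<open>0ca\<close> with the same word \<open>c\<close>.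
\<close>

section \<open>Polynomials with nonnegative coefficients\<close>

definition coeffs_nonneg :: "int poly \<Rightarrow> bool" where
  "coeffs_nonneg f \<longleftrightarrow> (\<forall>i. coeff f i \<ge> 0)"

definition coeffs_pos :: "int poly \<Rightarrow> bool" where
  "coeffs_pos f \<longleftrightarrow> coeffs_nonneg f \<and> f \<noteq> 0"

lemma poly_prec_iff: "f \<prec> g \<longleftrightarrow> coeffs_pos (g - f)"
  by (auto simp: poly_prec_def coeffs_pos_def coeffs_nonneg_def)

lemma coeffs_nonneg_0 [intro]: "coeffs_nonneg 0"
  and coeffs_nonneg_1 [intro]: "coeffs_nonneg 1"
  and coeffs_nonneg_qvar [intro]: "coeffs_nonneg qvar"
  by (auto simp: coeffs_nonneg_def coeff_pCons one_pCons split: nat.split)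

lemma coeffs_nonneg_add [intro]:
  "coeffs_nonneg f \<Longrightarrow> coeffs_nonneg g \<Longrightarrow> coeffs_nonneg (f + g)"
  by (auto simp: coeffs_nonneg_def)

lemma coeffs_nonneg_mult [intro]:
  "coeffs_nonneg f \<Longrightarrow> coeffs_nonneg g \<Longrightarrow> coeffs_nonneg (f * g)"
  by (auto simp: coeffs_nonneg_def coeff_mult intro!: sum_nonneg)

lemma coeffs_nonneg_power [intro]: "coeffs_nonneg f \<Longrightarrow> coeffs_nonneg (f ^ n)"
  by (induction n) auto

lemma coeffs_nonneg_numeral [intro]: "coeffs_nonneg (numeral n)"
  by (auto simp: coeffs_nonneg_def numeral_poly coeff_pCons split: nat.split)

lemma coeffs_pos_imp_nonneg [intro]: "coeffs_pos f \<Longrightarrow> coeffs_nonneg f"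
  by (simp add: coeffs_pos_def)

lemma coeffs_pos_1 [intro]: "coeffs_pos 1"
  and coeffs_pos_qvar [intro]: "coeffs_pos qvar"
  by (auto simp: coeffs_pos_def)

lemma coeffs_pos_mult [intro]: "coeffs_pos f \<Longrightarrow> coeffs_pos g \<Longrightarrow> coeffs_pos (f * g)"
  by (auto simp: coeffs_pos_def)

lemma coeffs_pos_power [intro]: "coeffs_pos f \<Longrightarrow> coeffs_pos (f ^ n)"
  by (induction n) auto

lemma coeffs_pos_add_nonneg [intro]:
  assumes "coeffs_pos f" "coeffs_nonneg g"
  shows "coeffs_pos (f + g)" "coeffs_pos (g + f)"
proof -
  obtain i where "coeff f i \<noteq> 0"
    using assms(1) by (auto simp: coeffs_pos_def poly_eq_iff)
  then have "coeff (f + g) i > 0"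
    using assms by (simp add: coeffs_pos_def coeffs_nonneg_def order_less_le add_nonneg_eq_0_iff)
  then have "f + g \<noteq> 0"
    by (metis coeff_0 less_irrefl)
  then show "coeffs_pos (f + g)"
    using assms by (auto simp: coeffs_pos_def)
  then show "coeffs_pos (g + f)"
    by (simp add: add.commute)
qed

lemmas coeffs_nonneg_intros = coeffs_nonneg_add coeffs_nonneg_mult coeffs_nonneg_power
  coeffs_nonneg_numeral coeffs_nonneg_qvar coeffs_nonneg_1

lemma coeffs_nonneg_diff_trans:
  assumes "coeffs_nonneg (g - f)" "coeffs_nonneg (h - g)"
  shows "coeffs_nonneg (h - f)"
  using coeffs_nonneg_add[OF assms] by simp

lemma coeffs_pos_diff_trans1:
  assumes "coeffs_pos (g - f)" "coeffs_nonneg (h - g)"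
  shows "coeffs_pos (h - f)"
  using coeffs_pos_add_nonneg(1)[OF assms] by simp

lemma coeffs_pos_diff_trans2:
  assumes "coeffs_nonneg (g - f)" "coeffs_pos (h - g)"
  shows "coeffs_pos (h - f)"
  using coeffs_pos_add_nonneg(1)[OF assms(2,1)] by simp

section \<open>Entries of \<open>\<mu>\<^sub>q\<close>\<close>

lemma matrix_mult_entry_2:
  fixes A B :: "'a :: semiring_1 ^ 2 ^ 2"
  shows "(A ** B) $ i $ j = A $ i $ 1 * B $ 1 $ j + A $ i $ 2 * B $ 2 $ j"
  by (simp add: matrix_matrix_mult_def sum_2)

lemma mu_q_Cons_entry:
  "mu_q (a # w) $ i $ j = mu_letter a $ i $ 1 * mu_q w $ 1 $ j + mu_letter a $ i $ 2 * mu_q w $ 2 $ j"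
  by (simp only: mu_q.simps matrix_mult_entry_2)

lemma mu_q_append_entry:
  "mu_q (u @ v) $ i $ j = mu_q u $ i $ 1 * mu_q v $ 1 $ j + mu_q u $ i $ 2 * mu_q v $ 2 $ j"
  by (simp only: mu_q_append matrix_mult_entry_2)

lemma mu_q_Nil_entry: "mu_q [] $ i $ j = (if i = j then 1 else 0)"
  by (simp add: mat_def)

lemma mu_letter_entry:
  "mu_letter L0 $ 1 $ 1 = qvar + qvar ^ 2" "mu_letter L0 $ 1 $ 2 = 1"
  "mu_letter L0 $ 2 $ 1 = qvar" "mu_letter L0 $ 2 $ 2 = 1"
  "mu_letter L1 $ 1 $ 1 = qvar + 2 * qvar ^ 2 + qvar ^ 3 + qvar ^ 4"
  "mu_letter L1 $ 1 $ 2 = 1 + qvar"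
  "mu_letter L1 $ 2 $ 1 = qvar + qvar ^ 2" "mu_letter L1 $ 2 $ 2 = 1"
  by simp_all

declare mu_letter.simps [simp del] mu_q.simps [simp del]

lemma mu_letter_coeffs_pos: "coeffs_pos (mu_letter a $ i $ j)"
  using exhaust_2[of i] exhaust_2[of j]
  by (cases a) (auto simp only: mu_letter_entry
      intro!: coeffs_pos_add_nonneg coeffs_pos_power coeffs_nonneg_intros)

lemma mu_q_coeffs_nonneg [intro]: "coeffs_nonneg (mu_q w $ i $ j)"
proof (induction w arbitrary: i j)
  case (Cons a w)
  then show ?case
    unfolding mu_q_Cons_entry using mu_letter_coeffs_pos by blast
qed (auto simp: mu_q_Nil_entry)

lemma mu_q_coeffs_pos: "w \<noteq> [] \<or> i = j \<Longrightarrow> coeffs_pos (mu_q w $ i $ j)"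
proof (induction w arbitrary: i j)
  case (Cons a w)
  have "coeffs_pos (mu_q w $ j $ j)"
    using Cons.IH by blast
  then show ?case
    unfolding mu_q_Cons_entry using mu_letter_coeffs_pos exhaust_2[of j] by blast
qed (auto simp: mu_q_Nil_entry)

text \<open>Each letter matrix \<open>M\<close> satisfies \<open>M = D^-1 M^T D\<close> with
  \<open>D = diag(q, 1)\<close>, so transposing a product reverses its word. The third equation
  carries a factor \<open>q\<close> to avoid a division.\<close>

lemma mu_q_rev:
  "mu_q (rev w) $ 1 $ 1 = mu_q w $ 1 $ 1"
  "mu_q (rev w) $ 2 $ 1 = qvar * mu_q w $ 1 $ 2"
  "qvar * mu_q (rev w) $ 1 $ 2 = mu_q w $ 2 $ 1"
  "mu_q (rev w) $ 2 $ 2 = mu_q w $ 2 $ 2"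
proof (induction w)
  case (Cons a w)
  \<comment> \<open>Makes the indeterminate an opaque ring element, so that its coefficient list
    stays hidden from \<open>algebra\<close>.\<close>
  obtain q where q: "qvar = q"
    by simp
  have sym: "mu_letter a $ 2 $ 1 = q * mu_letter a $ 1 $ 2"
    by (cases a) (simp_all only: mu_letter_entry distrib_left power2_eq_square mult_1_right q)
  have "((1::2) = 2) = False" "((2::2) = 1) = False"
    by simp_all
  note entries = rev.simps mu_q_append_entry mu_q_Cons_entry mu_q_Nil_entry this simp_thms
    if_True if_False sym q mult_zero_right mult_1_right add_0_right add_0_left
  note IH = Cons(1,2,4)[unfolded q] Cons(3)[unfolded q, symmetric]
  {
    case 1
    show ?case
      unfolding entries IH by algebra
  next
    case 2
    show ?case
      unfolding entries IH by algebra
  next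
    case 3
    show ?case
      unfolding entries IH by algebra
  next
    case 4
    show ?case
      unfolding entries IH by algebra
  }
qed (simp_all add: mu_q_Nil_entry)

lemma mu_q_snoc_12:
  "mu_q (p @ [L0]) $ 1 $ 2 = mu_q p $ 1 $ 1 + mu_q p $ 1 $ 2"
  "mu_q (p @ [L1]) $ 1 $ 2 = mu_q p $ 1 $ 1 * (1 + qvar) + mu_q p $ 1 $ 2"
  by (simp_all only: mu_q_append_entry mu_q_Cons_entry mu_q_Nil_entry mu_letter_entry) simp_all

text \<open>Each appended letter adds the upper left entry, times \<open>1\<close> or
  \<open>1 + q\<close>.\<close>

lemma mu_q_prefix_coeffs_nonneg: "coeffs_nonneg (mu_q (p @ y) $ 1 $ 2 - mu_q p $ 1 $ 2)"
proof (induction y rule: rev_induct)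
  case (snoc a y)
  have "coeffs_nonneg (mu_q ((p @ y) @ [a]) $ 1 $ 2 - mu_q (p @ y) $ 1 $ 2)"
    by (cases a; simp only: mu_q_snoc_12 add_diff_cancel_right')
      (intro coeffs_nonneg_intros mu_q_coeffs_nonneg)+
  from coeffs_nonneg_diff_trans[OF snoc.IH this] show ?case
    by simp
qed auto

section \<open>Exchanging two adjacent letters\<close>

text \<open>
  Determinant of the matrix formed by the first column of \<open>\<mu>\<^sub>q(x)\<close> and the second column of
  \<open>\<mu>\<^sub>q(y)\<close>. A common first letter of \<open>x\<close> and \<open>y\<close> only contributes its own determinant, a power
  of \<open>q\<close>.
\<close>

definition mu_cross :: "letter list \<Rightarrow> letter list \<Rightarrow> int poly" where
  "mu_cross x y = mu_q x $ 1 $ 1 * mu_q y $ 2 $ 2 - mu_q x $ 2 $ 1 * mu_q y $ 1 $ 2"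

lemma mu_cross_same_letter:
  "mu_cross (L0 # x) (L0 # y) = qvar ^ 2 * mu_cross x y"
  "mu_cross (L1 # x) (L1 # y) = qvar ^ 4 * mu_cross x y"
proof -
  obtain q where q: "qvar = q"
    by simp
  show "mu_cross (L0 # x) (L0 # y) = qvar ^ 2 * mu_cross x y"
    unfolding mu_cross_def mu_q_Cons_entry mu_letter_entry q by algebra
  show "mu_cross (L1 # x) (L1 # y) = qvar ^ 4 * mu_cross x y"
    unfolding mu_cross_def mu_q_Cons_entry mu_letter_entry q by algebra
qed

text \<open>All negative terms of the determinant cancel in the expansion, so its nonnegativity can
  be read off.\<close>

lemma mu_cross_L1_L0:
  "mu_cross (L1 # x) (L0 # y) =
    qvar ^ 5 * (mu_q x $ 1 $ 1 * mu_q y $ 1 $ 2)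
    + (qvar ^ 2 + qvar ^ 3 + qvar ^ 4) * (mu_q x $ 1 $ 1 * mu_q y $ 2 $ 2)
    + qvar * (mu_q x $ 2 $ 1 * mu_q y $ 2 $ 2)"
proof -
  obtain q where q: "qvar = q"
    by simp
  show ?thesis
    unfolding mu_cross_def mu_q_Cons_entry mu_letter_entry q by algebra
qed

text \<open>Once common first letters are removed, either one word is exhausted and a diagonal entry
  remains, or, by the assumption, \<open>x\<close> continues with \<open>L1\<close> and
  \<open>y\<close> with \<open>L0\<close>.\<close>

lemma mu_cross_coeffs_pos:
  assumes "\<And>z x' y'. \<not> (x = z @ L0 # x' \<and> y = z @ L1 # y')"
  shows "coeffs_pos (mu_cross x y)"
  using assms
proof (induction x arbitrary: y)
  case Nil
  show ?case
    using mu_q_coeffs_pos[of y 2 2] by (simp add: mu_cross_def mu_q_Nil_entry)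
next
  case (Cons a x)
  show ?case
  proof (cases y)
    case Nil
    then show ?thesis
      using mu_q_coeffs_pos[of "a # x" 1 1] by (simp add: mu_cross_def mu_q_Nil_entry)
  next
    case (Cons b y')
    have IH: "coeffs_pos (mu_cross x y')" if "a = b"
      using Cons.prems[of "a # _"] \<open>y = b # y'\<close> that by (intro Cons.IH) auto
    show ?thesis
    proof (cases "a = b")
      case True
      then show ?thesis
        using IH \<open>y = b # y'\<close> by (cases a) (auto simp only: mu_cross_same_letter
          intro!: coeffs_pos_mult coeffs_pos_power coeffs_pos_qvar)
    next
      case False
      with Cons.prems[of "[]"] \<open>y = b # y'\<close> have ab: "a = L1" "b = L0"
        by (cases a; cases b; auto)+
      show ?thesis
        unfolding ab \<open>y = b # y'\<close> mu_cross_L1_L0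
        by (rule coeffs_pos_add_nonneg(1), rule coeffs_pos_add_nonneg(2))
          (intro coeffs_pos_add_nonneg(1) coeffs_pos_mult coeffs_pos_power coeffs_pos_qvar
            mu_q_coeffs_pos coeffs_nonneg_intros mu_q_coeffs_nonneg disjI2 refl)+
    qed
  qed
qed

text \<open>The matrices of \<open>10\<close> and \<open>01\<close> differ by \<open>q + q^4\<close>
  times the matrix with rows \<open>(0, 1)\<close> and \<open>(-q, 0)\<close>. By
  \<open>mu_q_rev\<close>, the first row of \<open>p\<close> then becomes the first column of
  \<open>rev p\<close>.\<close>

lemma mu_q_exchange:
  "mu_q (p @ L1 # L0 # y) $ 1 $ 2 - mu_q (p @ L0 # L1 # y) $ 1 $ 2
    = (qvar + qvar ^ 4) * mu_cross (rev p) y"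
proof -
  obtain q where q: "qvar = q"
    by simp
  show ?thesis
    unfolding mu_cross_def mu_q_append_entry mu_q_Cons_entry mu_letter_entry mu_q_rev q
    by algebra
qed

lemma mu_q_exchange_coeffs_pos:
  assumes "\<And>z x' y'. \<not> (p = x' @ L0 # rev z \<and> y = z @ L1 # y')"
  shows "coeffs_pos (mu_q (p @ L1 # L0 # y) $ 1 $ 2 - mu_q (p @ L0 # L1 # y) $ 1 $ 2)"
proof -
  have "coeffs_pos (mu_cross (rev p) y)"
  proof (rule mu_cross_coeffs_pos)
    fix z x' y'
    show "\<not> (rev p = z @ L0 # x' \<and> y = z @ L1 # y')"
      using assms[of "rev x'" z y'] by (auto simp: rev_swap)
  qed
  then show ?thesis
    unfolding mu_q_exchange
    by (intro coeffs_pos_mult coeffs_pos_add_nonneg(1) coeffs_pos_qvar coeffs_nonneg_intros)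
qed

lemma mu_q_last_coeffs_pos:
  "coeffs_pos (mu_q (p @ [L1]) $ 1 $ 2 - mu_q (p @ [L0]) $ 1 $ 2)"
proof -
  have "mu_q (p @ [L1]) $ 1 $ 2 - mu_q (p @ [L0]) $ 1 $ 2 = mu_q p $ 1 $ 1 * qvar"
    unfolding mu_q_snoc_12 by (simp only: distrib_left)
  then show ?thesis
    by (simp only:) (intro coeffs_pos_mult mu_q_coeffs_pos coeffs_pos_qvar disjI2 refl)
qed

section \<open>Comparing words of consecutive lengths\<close>

text \<open>The letter matrices send the column \<open>(1, -q)\<close> to \<open>(q^2, 0)\<close>
  and \<open>(q^2 + q^3 + q^4, q^2)\<close>, where no negative coefficient is left.\<close>

lemma mu_q_11_minus_12:
  "mu_q (w @ [L0]) $ i $ 1 - qvar * mu_q (w @ [L0]) $ i $ 2 = qvar ^ 2 * mu_q w $ i $ 1"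
  "mu_q (w @ [L1]) $ i $ 1 - qvar * mu_q (w @ [L1]) $ i $ 2
     = (qvar ^ 2 + qvar ^ 3 + qvar ^ 4) * mu_q w $ i $ 1 + qvar ^ 2 * mu_q w $ i $ 2"
proof -
  obtain q where q: "qvar = q"
    by simp
  have [simp]: "(1::2) = 2 \<longleftrightarrow> False" "(2::2) = 1 \<longleftrightarrow> False"
    by simp_all
  show "mu_q (w @ [L0]) $ i $ 1 - qvar * mu_q (w @ [L0]) $ i $ 2 = qvar ^ 2 * mu_q w $ i $ 1"
    unfolding mu_q_append_entry mu_q_Cons_entry mu_q_Nil_entry mu_letter_entry q
    by simp algebra
  show "mu_q (w @ [L1]) $ i $ 1 - qvar * mu_q (w @ [L1]) $ i $ 2
     = (qvar ^ 2 + qvar ^ 3 + qvar ^ 4) * mu_q w $ i $ 1 + qvar ^ 2 * mu_q w $ i $ 2"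
    unfolding mu_q_append_entry mu_q_Cons_entry mu_q_Nil_entry mu_letter_entry q
    by simp algebra
qed

lemma mu_q_11_minus_12_coeffs_pos: "coeffs_pos (mu_q w $ 1 $ 1 - qvar * mu_q w $ 1 $ 2)"
proof (cases w rule: rev_cases)
  case Nil
  then show ?thesis
    by (auto simp: mu_q_Nil_entry)
next
  case (snoc y a)
  then show ?thesis
    by (cases a; simp only: mu_q_11_minus_12)
      (intro coeffs_pos_add_nonneg(1) coeffs_pos_mult coeffs_pos_power coeffs_pos_qvar
        mu_q_coeffs_pos coeffs_nonneg_intros mu_q_coeffs_nonneg disjI2 refl)+
qed

text \<open>Expansion by the last letter of \<open>c\<close>. Only the letter \<open>L0\<close>
  produces a negative term, and \<open>mu_q_11_minus_12_coeffs_pos\<close> absorbs it.\<close>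

lemma mu_q_L1_prec_L0_snoc_L0:
  "coeffs_pos (mu_q (L0 # c @ [L0]) $ 1 $ 2 - mu_q (L1 # c) $ 1 $ 2)"
proof -
  obtain q where q: "qvar = q"
    by simp
  have qpos: "coeffs_pos q" "coeffs_nonneg q"
    unfolding q[symmetric] by auto
  have [simp]: "(1::2) = 2 \<longleftrightarrow> False" "(2::2) = 1 \<longleftrightarrow> False"
    by simp_all
  show ?thesis
  proof (cases c rule: rev_cases)
    case Nil
    have "mu_q (L0 # c @ [L0]) $ 1 $ 2 - mu_q (L1 # c) $ 1 $ 2 = q ^ 2"
      unfolding Nil mu_q_append_entry mu_q_Cons_entry mu_q_Nil_entry mu_letter_entry q append_Nil
      by simp
    then show ?thesis
      using qpos by auto
  next
    case (snoc d a)
    let ?M = "\<lambda>i j. mu_q d $ i $ j"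
    show ?thesis
    proof (cases a)
      case L0
      have "mu_q (L0 # c @ [L0]) $ 1 $ 2 - mu_q (L1 # c) $ 1 $ 2
        = q ^ 2 * (q * (?M 1 1 - q * ?M 1 2) + ?M 2 1)"
        unfolding snoc L0 mu_q_append_entry mu_q_Cons_entry mu_q_Nil_entry mu_letter_entry q
        by simp algebra
      moreover have "coeffs_pos \<dots>"
        by (intro coeffs_pos_mult coeffs_pos_add_nonneg(1) coeffs_pos_power qpos
            mu_q_11_minus_12_coeffs_pos[of d, unfolded q] mu_q_coeffs_nonneg)
      ultimately show ?thesis
        by (simp only:)
    next
      case L1
      have "mu_q (L0 # c @ [L0]) $ 1 $ 2 - mu_q (L1 # c) $ 1 $ 2
        = (q ^ 3 + q ^ 4 + q ^ 5 + q ^ 6) * ?M 1 1 + (q ^ 2 + q ^ 3 + q ^ 4) * ?M 2 1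
          + q ^ 3 * ?M 1 2 + q ^ 2 * ?M 2 2"
        unfolding snoc L1 mu_q_append_entry mu_q_Cons_entry mu_q_Nil_entry mu_letter_entry q
        by simp algebra
      moreover have "coeffs_pos \<dots>"
        by (intro coeffs_pos_add_nonneg(1) coeffs_pos_mult coeffs_pos_power mu_q_coeffs_pos
            coeffs_nonneg_intros mu_q_coeffs_nonneg qpos disjI2 refl)
      ultimately show ?thesis
        by (simp only:)
    qed
  qed
qed

lemma mu_q_L1_prec_L0_snoc:
  "coeffs_pos (mu_q (L0 # c @ [a]) $ 1 $ 2 - mu_q (L1 # c) $ 1 $ 2)"
proof (cases a)
  case L1
  then show ?thesis
    using coeffs_pos_diff_trans1[OF mu_q_L1_prec_L0_snoc_L0[of c]
        coeffs_pos_imp_nonneg[OF mu_q_last_coeffs_pos[of "L0 # c", unfolded append_Cons]]]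
    by simp
qed (simp add: mu_q_L1_prec_L0_snoc_L0)

section \<open>Words close to a line of given slope\<close>

definition prefix_count :: "letter list \<Rightarrow> nat \<Rightarrow> nat" where
  "prefix_count w i = count_list (take i w) L1"

text \<open>A pair of indices stands for the factor between them. Stated through heights over the
  line of slope \<alpha>, the condition says that these vary by less than 1.\<close>

definition tight :: "real \<Rightarrow> letter list \<Rightarrow> bool" where
  "tight \<alpha> w \<longleftrightarrow> (\<forall>i\<le>length w. \<forall>j\<le>length w.
    \<bar>(real (prefix_count w j) - \<alpha> * real j) - (real (prefix_count w i) - \<alpha> * real i)\<bar> < 1)"

lemma tightD:
  assumes "tight \<alpha> w" "i \<le> length w" "j \<le> length w"
  shows "(real (prefix_count w j) - \<alpha> * real j) - (real (prefix_count w i) - \<alpha> * real i) < 1"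
  using assms unfolding tight_def by fastforce

lemma prefix_count_0 [simp]: "prefix_count w 0 = 0"
  by (simp add: prefix_count_def)

lemma prefix_count_append:
  "prefix_count (u @ v) i = prefix_count u i + prefix_count v (i - length u)"
  by (simp add: prefix_count_def)

lemma prefix_count_Cons:
  "prefix_count (a # w) i = (if i = 0 then 0 else of_bool (a = L1) + prefix_count w (i - 1))"
  by (cases i) (auto simp: prefix_count_def)

lemma prefix_count_Nil [simp]: "prefix_count [] i = 0"
  by (simp add: prefix_count_def)

lemma prefix_count_all: "length w \<le> i \<Longrightarrow> prefix_count w i = count_list w L1"
  by (simp add: prefix_count_def)

lemma prefix_count_Suc:
  "i < length w \<Longrightarrow> prefix_count w (Suc i) = prefix_count w i + of_bool (w ! i = L1)"
  by (simp add: prefix_count_def take_Suc_conv_app_nth)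

lemma prefix_count_inject:
  assumes "length u = length v" "\<And>i. i \<le> length u \<Longrightarrow> prefix_count u i = prefix_count v i"
  shows "u = v"
proof (rule nth_equalityI)
  fix i assume i: "i < length u"
  then have "of_bool (u ! i = L1) = (of_bool (v ! i = L1) :: nat)"
    using assms(2)[of i] assms(2)[of "Suc i"] assms(1)
    by (simp add: prefix_count_Suc)
  then show "u ! i = v ! i"
    by (cases "u ! i"; cases "v ! i") auto
qed (fact assms)

lemma tight_factor:
  assumes "tight \<alpha> (x @ f @ y)"
  shows "\<bar>real (count_list f L1) - \<alpha> * real (length f)\<bar> < 1"
proof -
  have "prefix_count (x @ f @ y) (length x) = count_list x L1"
    "prefix_count (x @ f @ y) (length x + length f) = count_list x L1 + count_list f L1"
    by (simp_all add: prefix_count_append prefix_count_all)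
  then show ?thesis
    using assms[unfolded tight_def, rule_format, of "length x" "length x + length f"]
    by (simp add: algebra_simps)
qed

text \<open>The factors \<open>0 rev z 0\<close> and \<open>1 z 1\<close> have equal length, but
  their counts differ by 2, so they cannot both be within 1 of the same number.\<close>

lemma tight_no_00_11:
  assumes "tight \<alpha> (x @ L0 # rev z @ L0 # L1 # z @ L1 # y)"
  shows False
proof -
  have "\<bar>real (count_list (L0 # rev z @ [L0]) L1) - \<alpha> * real (length (L0 # rev z @ [L0]))\<bar> < 1"
    by (rule tight_factor[of _ x _ "L1 # z @ L1 # y"]) (use assms in simp)
  moreover have
    "\<bar>real (count_list (L1 # z @ [L1]) L1) - \<alpha> * real (length (L1 # z @ [L1]))\<bar> < 1"
    by (rule tight_factor[of _ "x @ L0 # rev z @ [L0]" _ y]) (use assms in simp)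
  ultimately show False
    by (simp add: count_list_rev)
qed

lemma tight_take:
  assumes "tight \<alpha> w"
  shows "tight \<alpha> (take n w)"
  using assms by (auto simp: tight_def prefix_count_def min_def)

text \<open>
  Raising the prefix count at one index \<open>i\<close> means replacing a factor \<open>01\<close> by \<open>10\<close>, or a final
  \<open>0\<close> by \<open>1\<close>. The index where \<open>u\<close> is lowest relative to the line, among those where \<open>v\<close> exceeds \<open>u\<close>,
  can be raised without leaving the class of tight words.
\<close>

lemma tight_raise:
  assumes \<alpha>: "\<alpha> \<notin> \<rat>" "0 < \<alpha>" "\<alpha> < 1"
    and len: "length u = length v" and tight: "tight \<alpha> u" "tight \<alpha> v"
    and le: "\<And>i. i \<le> length u \<Longrightarrow> prefix_count u i \<le> prefix_count v i" and "u \<noteq> v"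
  obtains u' i where "length u' = length u" "tight \<alpha> u'" "i \<le> length u"
    "prefix_count u i < prefix_count v i"
    "\<And>j. j \<le> length u \<Longrightarrow> prefix_count u' j = prefix_count u j + of_bool (j = i)"
    "coeffs_pos (mu_q u' $ 1 $ 2 - mu_q u $ 1 $ 2)"
proof -
  define n where "n = length u"
  define e where "e i = real (prefix_count u i) - \<alpha> * real i" for i
  define T where "T = {i. i \<le> n \<and> prefix_count u i < prefix_count v i}"
  have "finite T"
    by (auto simp: T_def)
  moreover have "T \<noteq> {}"
    using prefix_count_inject[OF len] \<open>u \<noteq> v\<close> le by (force simp: T_def n_def)
  ultimately obtain i where i: "i \<in> T" and min: "\<And>j. j \<in> T \<Longrightarrow> e i \<le> e j"
    by (metis arg_min_if_finite(1) arg_min_least)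
  have i_le: "i \<le> n" and i_less: "prefix_count u i < prefix_count v i"
    using i by (auto simp: T_def)
  \<comment> \<open>Inside \<open>T\<close> a tie would make \<alpha> rational. Outside
    \<open>T\<close> both words agree at \<open>j\<close> while \<open>v\<close> is at least one
    higher at \<open>i\<close>, so tightness of \<open>v\<close> gives the inequality.\<close>
  have lowest: "e i < e j" if "j \<le> n" "j \<noteq> i" for j
  proof (cases "j \<in> T")
    case True
    have "e i \<noteq> e j"
    proof
      assume "e i = e j"
      then have "\<alpha> * (real i - real j) = real (prefix_count u i) - real (prefix_count u j)"
        by (simp add: e_def algebra_simps)
      then have "\<alpha> = (real (prefix_count u i) - real (prefix_count u j)) / (real i - real j)"
        using \<open>j \<noteq> i\<close> by (simp add: field_simps)
      also have "\<dots> \<in> \<rat>"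
        by auto
      finally show False
        using \<alpha> by simp
    qed
    with min[OF True] show ?thesis
      by simp
  next
    case False
    then have "prefix_count u j = prefix_count v j"
      using le[of j] that by (auto simp: T_def n_def)
    then show ?thesis
      using tightD[OF tight(2), of j i] i_less that i_le len by (simp add: e_def n_def)
  qed
  have "i \<noteq> 0"
    using i_less by (metis less_irrefl prefix_count_0)
  then obtain k where k: "i = Suc k"
    by (cases i) auto
  \<comment> \<open>A letter \<open>L1\<close> before the lowest point would put index
    \<open>k\<close> even lower, as \<alpha> < 1. Likewise a letter \<open>L0\<close> after it would
    put the next index lower, as \<alpha> > 0.\<close>
  have "u ! k = L0"
    using lowest[of k] i_le prefix_count_Suc[of k u] \<alpha>
    by (cases "u ! k") (auto simp: k e_def n_def algebra_simps)
  then have u_split: "u = take k u @ L0 # drop i u"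
    using i_le by (metis Suc_le_lessD id_take_nth_drop k n_def)
  \<comment> \<open>Since \<open>e i\<close> is strictly lowest, \<open>e i + 1\<close> exceeds
    every other height by less than 1.\<close>
  have tight_if: "tight \<alpha> u'" if "length u' = n"
    and u': "\<And>j. j \<le> n \<Longrightarrow> prefix_count u' j = prefix_count u j + of_bool (j = i)" for u'
    unfolding tight_def
  proof (intro allI impI)
    fix j j' assume "j \<le> length u'" "j' \<le> length u'"
    then have "j \<le> n" "j' \<le> n"
      using that by auto
    then show "\<bar>real (prefix_count u' j') - \<alpha> * real j' - (real (prefix_count u' j) - \<alpha> * real j)\<bar> < 1"
      using tightD[OF tight(1), of j j'] tightD[OF tight(1), of j' j] lowest[of j] lowest[of j']
      by (auto simp: u' e_def n_def abs_less_iff)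
  qed
  show thesis
  proof (cases "i < n")
    case False
    then have "drop i u = []"
      by (simp add: n_def)
    define p where "p = take k u"
    have u: "u = p @ [L0]"
      using u_split \<open>drop i u = []\<close> by (simp add: p_def)
    have cnt: "prefix_count (p @ [L1]) j = prefix_count u j + of_bool (j = i)" if "j \<le> n" for j
      using that False i_le u k
      by (auto simp: n_def prefix_count_append prefix_count_Cons)
    show thesis
      using that[of "p @ [L1]" i] tight_if[of "p @ [L1]"] cnt i_le i_less mu_q_last_coeffs_pos[of p]
      by (simp add: n_def u)
  next
    case True
    then have "u ! i = L1"
      using lowest[of "Suc i"] prefix_count_Suc[of i u] \<alpha>
      by (cases "u ! i") (auto simp: e_def n_def algebra_simps)
    then have "drop i u = L1 # drop (Suc i) u"
      using True by (metis Cons_nth_drop_Suc n_def)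
    define p y where "p = take k u" and "y = drop (Suc i) u"
    have u: "u = p @ L0 # L1 # y"
      using u_split \<open>drop i u = L1 # drop (Suc i) u\<close> by (simp add: p_def y_def)
    have "length p = k"
      using i_le by (simp add: p_def n_def k)
    then have cnt: "prefix_count (p @ L1 # L0 # y) j = prefix_count u j + of_bool (j = i)"
      if "j \<le> n" for j
      by (auto simp: u k prefix_count_append prefix_count_Cons)
    have "coeffs_pos (mu_q (p @ L1 # L0 # y) $ 1 $ 2 - mu_q (p @ L0 # L1 # y) $ 1 $ 2)"
    proof (rule mu_q_exchange_coeffs_pos)
      fix z x' y'
      show "\<not> (p = x' @ L0 # rev z \<and> y = z @ L1 # y')"
        using tight_no_00_11[of \<alpha> x' z y'] tight(1) u by auto
    qed
    then show thesis
      using that[of "p @ L1 # L0 # y" i] tight_if[of "p @ L1 # L0 # y"] cnt i_le i_less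
      by (simp add: n_def u)
  qed
qed

text \<open>Iterates \<open>tight_raise\<close>: each raise stays below \<open>v\<close> and
  decreases the total gap between the prefix counts.\<close>

lemma tight_pointwise_le:
  assumes \<alpha>: "\<alpha> \<notin> \<rat>" "0 < \<alpha>" "\<alpha> < 1"
    and "length u = length v" "tight \<alpha> u" "tight \<alpha> v"
    and "\<And>i. i \<le> length u \<Longrightarrow> prefix_count u i \<le> prefix_count v i"
  shows "u = v \<or> coeffs_pos (mu_q v $ 1 $ 2 - mu_q u $ 1 $ 2)"
  using assms(4-)
proof (induction "\<Sum>i\<le>length u. prefix_count v i - prefix_count u i" arbitrary: u rule: less_induct)
  case less
  show ?case
  proof (cases "u = v")
    case False
    obtain u' i where u': "length u' = length u" "tight \<alpha> u'" "i \<le> length u"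
      "prefix_count u i < prefix_count v i"
      "\<And>j. j \<le> length u \<Longrightarrow> prefix_count u' j = prefix_count u j + of_bool (j = i)"
      "coeffs_pos (mu_q u' $ 1 $ 2 - mu_q u $ 1 $ 2)"
      using tight_raise[OF \<alpha> less.prems False] by metis
    have "u' = v \<or> coeffs_pos (mu_q v $ 1 $ 2 - mu_q u' $ 1 $ 2)"
    proof (rule less.hyps)
      show "(\<Sum>i\<le>length u'. prefix_count v i - prefix_count u' i)
          < (\<Sum>i\<le>length u. prefix_count v i - prefix_count u i)"
        unfolding u'(1)
      proof (rule sum_strict_mono_ex1)
        show "\<exists>j\<in>{..length u}. prefix_count v j - prefix_count u' j < prefix_count v j - prefix_count u j"
          using u' by (intro bexI[of _ i]) auto
      qed (use u' in auto)
      show "prefix_count u' j \<le> prefix_count v j" if "j \<le> length u'" for j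
        using that less.prems(4)[of j] u' by (cases "j = i") auto
    qed (use u' less.prems in auto)
    then show ?thesis
      using u'(6) coeffs_pos_diff_trans1 by blast
  qed simp
qed

text \<open>Just after the common prefix \<open>v\<close> is one ahead. If \<open>u\<close> were
  ahead at \<open>j\<close>, the increments of the two words between these indices would differ by
  at least 2, but tightness keeps each within 1 of the same multiple of \<alpha>.\<close>

lemma tight_lexord_pointwise_le:
  assumes "length u = length v" "tight \<alpha> u" "tight \<alpha> v" "(u, v) \<in> lexord {(L0, L1)}"
    and "j \<le> length u"
  shows "prefix_count u j \<le> prefix_count v j"
proof -
  obtain p x y where u: "u = p @ L0 # x" and v: "v = p @ L1 # y"
    using assms(1,4) by (auto simp: lexord_def)
  define k where "k = Suc (length p)"
  have k: "prefix_count v k = prefix_count u k + 1"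
    by (simp add: u v k_def prefix_count_append prefix_count_Cons)
  have "k \<le> length u"
    by (simp add: u k_def)
  then show ?thesis
    using tightD[OF assms(2), of k j] tightD[OF assms(3), of j k] assms(1,5) k
    by (simp add: k_def)
qed

section \<open>Extremal tight words\<close>

text \<open>The lower mechanical word of slope \<alpha> and intercept 0; its prefix counts are the
  least possible for tight words.\<close>

definition floor_word :: "real \<Rightarrow> nat \<Rightarrow> letter list" where
  "floor_word \<alpha> n = map (\<lambda>i. if \<lfloor>\<alpha> * real (Suc i)\<rfloor> = \<lfloor>\<alpha> * real i\<rfloor> then L0 else L1) [0..<n]"

lemma length_floor_word [simp]: "length (floor_word \<alpha> n) = n"
  by (simp add: floor_word_def)

lemma floor_word_Suc: "floor_word \<alpha> (Suc n) =
    floor_word \<alpha> n @ [if \<lfloor>\<alpha> * real (Suc n)\<rfloor> = \<lfloor>\<alpha> * real n\<rfloor> then L0 else L1]"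
  by (simp add: floor_word_def)

lemma prefix_count_floor_word:
  assumes "0 < \<alpha>" "\<alpha> < 1" "i \<le> n"
  shows "int (prefix_count (floor_word \<alpha> n) i) = \<lfloor>\<alpha> * real i\<rfloor>"
  using assms(3)
proof (induction i)
  case (Suc i)
  have "\<lfloor>\<alpha> * real (Suc i)\<rfloor> = \<lfloor>\<alpha> * real i\<rfloor> \<or> \<lfloor>\<alpha> * real (Suc i)\<rfloor> = \<lfloor>\<alpha> * real i\<rfloor> + 1"
    using assms(1,2) by (simp add: distrib_left) linarith
  with Suc show ?case
    by (auto simp: prefix_count_Suc floor_word_def simp del: of_nat_Suc)
qed simp

lemma tight_floor_word:
  assumes "0 < \<alpha>" "\<alpha> < 1"
  shows "tight \<alpha> (floor_word \<alpha> n)"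
  unfolding tight_def
proof (intro allI impI)
  fix i j assume "i \<le> length (floor_word \<alpha> n)" "j \<le> length (floor_word \<alpha> n)"
  then have "real (prefix_count (floor_word \<alpha> n) i) = of_int \<lfloor>\<alpha> * real i\<rfloor>"
    "real (prefix_count (floor_word \<alpha> n) j) = of_int \<lfloor>\<alpha> * real j\<rfloor>"
    using prefix_count_floor_word[OF assms, of _ n] by (metis length_floor_word of_int_of_nat_eq)+
  then show "\<bar>real (prefix_count (floor_word \<alpha> n) j) - \<alpha> * real j
      - (real (prefix_count (floor_word \<alpha> n) i) - \<alpha> * real i)\<bar> < 1"
    by linarith
qed

lemma tight_prefix_count_floor:
  assumes "tight \<alpha> w" "i \<le> length w"
  shows "\<lfloor>\<alpha> * real i\<rfloor> \<le> int (prefix_count w i)" "int (prefix_count w i) \<le> \<lfloor>\<alpha> * real i\<rfloor> + 1"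
  using tightD[OF assms(1), of 0 i] tightD[OF assms(1), of i 0] assms(2) by simp_all linarith+

lemma floor_word_Cons:
  assumes "0 < \<alpha>" "\<alpha> < 1"
  obtains c where "floor_word \<alpha> (Suc n) = L0 # c" "length c = n"
proof -
  have "\<lfloor>\<alpha>\<rfloor> = 0"
    using assms by linarith
  then have "floor_word \<alpha> (Suc n) = L0 # tl (floor_word \<alpha> (Suc n))"
    by (simp add: floor_word_def upt_rec del: upt_Suc)
  then show thesis
    using that by (metis length_floor_word length_tl diff_Suc_1)
qed

text \<open>Changing the first letter raises all later prefix counts by one. By irrationality they
  become the ceilings of \<open>\<alpha> * i\<close>, so all heights lie in \<open>[0, 1)\<close>:
  this is the upper mechanical word.\<close>

lemma tight_floor_word_L1:
  assumes \<alpha>: "\<alpha> \<notin> \<rat>" "0 < \<alpha>" "\<alpha> < 1" and c: "floor_word \<alpha> n = L0 # c"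
  shows "tight \<alpha> (L1 # c)"
    and "0 < i \<Longrightarrow> i \<le> n \<Longrightarrow> int (prefix_count (L1 # c) i) = \<lfloor>\<alpha> * real i\<rfloor> + 1"
proof -
  have len: "length (L1 # c) = n"
    by (metis c length_Cons length_floor_word)
  have cnt: "int (prefix_count (L1 # c) i) = \<lfloor>\<alpha> * real i\<rfloor> + 1" if "0 < i" "i \<le> n" for i
    using prefix_count_floor_word[OF \<alpha>(2,3) that(2)] that(1) by (simp add: c prefix_count_Cons)
  then show "0 < i \<Longrightarrow> i \<le> n \<Longrightarrow> int (prefix_count (L1 # c) i) = \<lfloor>\<alpha> * real i\<rfloor> + 1" .
  have irrat: "of_int \<lfloor>\<alpha> * real i\<rfloor> < \<alpha> * real i" if "0 < i" for i
  proof -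
    have "of_int \<lfloor>\<alpha> * real i\<rfloor> \<noteq> \<alpha> * real i"
    proof
      assume "of_int \<lfloor>\<alpha> * real i\<rfloor> = \<alpha> * real i"
      then have "\<alpha> = of_int \<lfloor>\<alpha> * real i\<rfloor> / real i"
        using that by (metis less_numeral_extra(3) nonzero_mult_div_cancel_right of_nat_0_eq_iff)
      also have "\<dots> \<in> \<rat>"
        by auto
      finally show False
        using \<alpha> by simp
    qed
    then show ?thesis
      by linarith
  qed
  have ceil: "0 \<le> real (prefix_count (L1 # c) i) - \<alpha> * real i \<and>
    real (prefix_count (L1 # c) i) - \<alpha> * real i < 1" if "i \<le> n" for i
  proof (cases "i = 0")
    case False
    then have "real (prefix_count (L1 # c) i) = of_int \<lfloor>\<alpha> * real i\<rfloor> + 1"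
      using cnt[of i] that by (metis gr0I of_int_1 of_int_add of_int_of_nat_eq)
    then show ?thesis
      using irrat[of i] False by linarith
  qed simp
  show "tight \<alpha> (L1 # c)"
    unfolding tight_def len using ceil by (auto simp: abs_less_iff) (smt (verit))+
qed

text \<open>The upper right entry grows along the chain \<open>u\<close>, \<open>1c\<close>,
  \<open>0ca\<close>, \<open>v'\<close>, \<open>v\<close>, strictly from \<open>1c\<close> to
  \<open>0ca\<close>. Here \<open>v'\<close> is the prefix of \<open>v\<close> of length
  \<open>length u + 1\<close>.\<close>

lemma tight_longer_coeffs_pos:
  assumes \<alpha>: "\<alpha> \<notin> \<rat>" "0 < \<alpha>" "\<alpha> < 1"
    and tight: "tight \<alpha> u" "tight \<alpha> v" and len: "length u < length v"
  shows "coeffs_pos (mu_q v $ 1 $ 2 - mu_q u $ 1 $ 2)"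
proof (cases "length u")
  case 0
  then show ?thesis
    using len mu_q_coeffs_pos[of v 1 2] by (simp add: mu_q_Nil_entry)
next
  case (Suc n)
  obtain c where c: "floor_word \<alpha> (Suc n) = L0 # c" and len_c: "length c = n"
    using floor_word_Cons[OF \<alpha>(2,3)] by metis
  obtain a where c': "floor_word \<alpha> (Suc (Suc n)) = L0 # c @ [a]"
    by (simp add: floor_word_Suc[of _ "Suc n"] c)
  define v' where "v' = take (Suc (Suc n)) v"
  have len_v': "length v' = Suc (Suc n)"
    using len Suc by (simp add: v'_def)
  have v'_tight: "tight \<alpha> v'"
    unfolding v'_def by (rule tight_take) (fact tight)
  have "u = L1 # c \<or> coeffs_pos (mu_q (L1 # c) $ 1 $ 2 - mu_q u $ 1 $ 2)"
  proof (rule tight_pointwise_le[OF \<alpha>])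
    show "prefix_count u i \<le> prefix_count (L1 # c) i" if "i \<le> length u" for i
      using tight_prefix_count_floor(2)[OF tight(1) that] tight_floor_word_L1(2)[OF \<alpha> c, of i]
        that Suc by (cases "i = 0") auto
  qed (use tight tight_floor_word_L1[OF \<alpha> c] Suc len_c in auto)
  then have 1: "coeffs_nonneg (mu_q (L1 # c) $ 1 $ 2 - mu_q u $ 1 $ 2)"
    by auto
  have "floor_word \<alpha> (Suc (Suc n)) = v'
      \<or> coeffs_pos (mu_q v' $ 1 $ 2 - mu_q (floor_word \<alpha> (Suc (Suc n))) $ 1 $ 2)"
  proof (rule tight_pointwise_le[OF \<alpha>])
    show "prefix_count (floor_word \<alpha> (Suc (Suc n))) i \<le> prefix_count v' i"
      if "i \<le> length (floor_word \<alpha> (Suc (Suc n)))" for i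
      using tight_prefix_count_floor(1)[OF v'_tight, of i]
        prefix_count_floor_word[OF \<alpha>(2,3), of i "Suc (Suc n)"] that len_v' by simp
  qed (use v'_tight tight_floor_word[OF \<alpha>(2,3)] len_v' in auto)
  then have 2: "coeffs_nonneg (mu_q v' $ 1 $ 2 - mu_q (L0 # c @ [a]) $ 1 $ 2)"
    unfolding c' by auto
  have 3: "coeffs_nonneg (mu_q v $ 1 $ 2 - mu_q v' $ 1 $ 2)"
    using mu_q_prefix_coeffs_nonneg[of v' "drop (Suc (Suc n)) v"] by (simp add: v'_def)
  show ?thesis
    using coeffs_pos_diff_trans1[OF coeffs_pos_diff_trans2[OF 1 mu_q_L1_prec_L0_snoc]
        coeffs_nonneg_diff_trans[OF 2 3]] .
qed

section \<open>The slope of a balanced sequence\<close>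

lemma length_factor [simp]: "length (factor s k n) = n"
  by (simp add: factor_def)

lemma factor_add: "factor s k (m + n) = factor s k m @ factor s (k + int m) n"
  by (induction n) (simp_all add: factor_def add.assoc)

lemma balanced_factor:
  assumes "balanced s"
  shows "int (count_list (factor s a n) L1) \<le> int (count_list (factor s b n) L1) + 1"
proof (cases "n \<ge> 1")
  case True
  then have "\<bar>int (count_list (factor s a n) L1) - int (count_list (factor s b n) L1)\<bar> \<le> 1"
    using assms unfolding balanced_def language_def by fastforce
  then show ?thesis
    by simp
qed (simp add: factor_def)

text \<open>Says that the lower slope bound \<open>(A - 1) / l\<close> of one factor is below the
  upper bound \<open>(B + 1) / m\<close> of any other. As in the subtractive Euclidean algorithm, a
  prefix of the shorter length is cut off the longer factor and compared by balance.\<close>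

lemma balanced_slope_less:
  assumes "balanced s" "l \<ge> 1" "m \<ge> 1"
  shows "int m * (int (count_list (factor s a l) L1) - 1)
       < int l * (int (count_list (factor s b m) L1) + 1)"
  using assms(2,3)
proof (induction "l + m" arbitrary: l m a b rule: less_induct)
  case less
  let ?A = "int (count_list (factor s a l) L1)" and ?B = "int (count_list (factor s b m) L1)"
  consider "l = m" | "l < m" | "m < l"
    by linarith
  then show ?case
  proof cases
    case 1
    have "?A \<le> ?B + 1"
      using balanced_factor[OF assms(1)] 1 by simp
    then show ?thesis
      using 1 less.prems by simp
  next
    case 2
    then obtain d where d: "m = l + d" "d \<ge> 1"
      by (metis less_imp_Suc_add add_Suc_right le_add1 plus_1_eq_Suc)
    let ?B' = "int (count_list (factor s (b + int l) d) L1)"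
    have B: "?B = int (count_list (factor s b l) L1) + ?B'"
      by (simp add: d factor_add)
    have "int d * (?A - 1) < int l * (?B' + 1)"
      using less.hyps[of l d a "b + int l"] less.prems d by simp
    also have "\<dots> \<le> int l * (?B - ?A + 2)"
      using balanced_factor[OF assms(1), of a l b] B by (intro mult_left_mono) auto
    finally show ?thesis
      by (simp add: d algebra_simps)
  next
    case 3
    then obtain d where d: "l = m + d" "d \<ge> 1"
      by (metis less_imp_Suc_add add_Suc_right le_add1 plus_1_eq_Suc)
    let ?A' = "int (count_list (factor s (a + int m) d) L1)"
    have A: "?A = int (count_list (factor s a m) L1) + ?A'"
      by (simp add: d factor_add)
    have "int m * (?A - ?B - 2) \<le> int m * (?A' - 1)"
      using balanced_factor[OF assms(1), of a m b] A by (intro mult_left_mono) auto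
    also have "\<dots> < int d * (?B + 1)"
      using less.hyps[of d m "a + int m" b] less.prems d by simp
    finally show ?thesis
      by (simp add: d algebra_simps)
  qed
qed

lemma exists_irrational_between:
  fixes a b :: real
  assumes "a < b"
  obtains x where "a < x" "x < b" "x \<notin> \<rat>"
proof -
  have "uncountable {a<..<b}"
    using assms by (simp add: uncountable_open_interval)
  then have "\<not> {a<..<b} \<subseteq> \<rat>"
    using countable_rat countable_subset by blast
  then show thesis
    using that by (meson greaterThanLessThan_iff subsetI)
qed

lemma finite_letter_UNIV: "finite (UNIV :: letter set)"
proof -
  have "(UNIV :: letter set) = {L0, L1}"
    using letter.exhaust by auto
  then show ?thesis
    by (metis finite.emptyI finite_insert)
qed

text \<open>Only finitely many words have length at most \<open>N\<close>, so the admissible slopes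
  form a nonempty open interval, which contains an irrational number. Without the bound
  \<open>N\<close> it could shrink to a rational point, as for periodic sequences.\<close>

lemma balanced_slope:
  assumes "balanced s"
  obtains \<alpha> where "\<alpha> \<notin> \<rat>" "0 < \<alpha>" "\<alpha> < 1"
    "\<And>k n. n \<le> N \<Longrightarrow> \<bar>real (count_list (factor s k n) L1) - \<alpha> * real n\<bar> < 1"
proof -
  define F where "F = {w \<in> language s. 1 \<le> length w \<and> length w \<le> N}"
  define lo where "lo w = (real (count_list w L1) - 1) / real (length w)" for w
  define hi where "hi w = (real (count_list w L1) + 1) / real (length w)" for w
  have "F \<subseteq> {w. set w \<subseteq> UNIV \<and> length w \<le> N}"
    by (auto simp: F_def)
  then have "finite F"
    using finite_lists_length_le[OF finite_letter_UNIV] by (rule finite_subset)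
  have lo_hi: "lo w < hi w'" if F: "w \<in> F" "w' \<in> F" for w w'
  proof -
    obtain a l b m where w: "w = factor s a l" "w' = factor s b m"
      using F unfolding F_def language_def by blast
    then have lm: "l \<ge> 1" "m \<ge> 1"
      using F by (auto simp: F_def)
    have "real_of_int (int m * (int (count_list w L1) - 1))
        < real_of_int (int l * (int (count_list w' L1) + 1))"
      unfolding of_int_less_iff w by (rule balanced_slope_less[OF assms lm])
    then show ?thesis
      using lm by (simp add: lo_def hi_def w field_simps)
  qed
  have lo_1: "lo w < 1" and hi_0: "0 < hi w" if "w \<in> F" for w
  proof -
    have "0 < real (length w)" "real (count_list w L1) \<le> real (length w)"
      using that count_le_length[of w L1] by (auto simp: F_def)
    then show "lo w < 1" "0 < hi w"
      by (simp_all add: lo_def hi_def)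
  qed
  \<comment> \<open>The inserted 0 and 1 force \<alpha> into the unit interval and cover the case of
    empty \<open>F\<close>.\<close>
  let ?lo = "Max (insert 0 (lo ` F))" and ?hi = "Min (insert 1 (hi ` F))"
  have "?lo < ?hi"
    using \<open>finite F\<close> lo_hi lo_1 hi_0 by auto
  then obtain \<alpha> where \<alpha>: "?lo < \<alpha>" "\<alpha> < ?hi" "\<alpha> \<notin> \<rat>"
    using exists_irrational_between by blast
  have "\<bar>real (count_list (factor s k n) L1) - \<alpha> * real n\<bar> < 1" if "n \<le> N" for k n
  proof (cases "n = 0")
    case False
    then have F: "factor s k n \<in> F"
      using that by (auto simp: F_def language_def)
    have "lo (factor s k n) < \<alpha>" "\<alpha> < hi (factor s k n)"
      using \<alpha> \<open>finite F\<close> F by auto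
    then show ?thesis
      using False by (auto simp: lo_def hi_def abs_less_iff field_simps)
  qed (simp add: factor_def)
  moreover have "0 < \<alpha>" "\<alpha> < 1"
    using \<alpha> \<open>finite F\<close> by auto
  ultimately show thesis
    using that \<alpha>(3) by blast
qed

lemma tight_if_in_language:
  assumes "\<And>k n. n \<le> N \<Longrightarrow> \<bar>real (count_list (factor s k n) L1) - \<alpha> * real n\<bar> < 1"
    and "w \<in> language s" "length w \<le> N"
  shows "tight \<alpha> w"
proof -
  obtain k where w: "w = factor s k (length w)"
    using assms(2) by (auto simp: language_def)
  have prefix: "prefix_count w i = count_list (factor s k i) L1" if "i \<le> length w" for i
  proof -
    have "w = factor s k i @ factor s (k + int i) (length w - i)"
      using w that by (metis factor_add le_add_diff_inverse)
    then show ?thesis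
      by (metis length_factor order_refl prefix_count_def append_eq_conv_conj)
  qed
  have diff: "\<bar>(real (prefix_count w (i + d)) - \<alpha> * real (i + d)) - (real (prefix_count w i) - \<alpha> * real i)\<bar> < 1"
    if "i + d \<le> length w" for i d
    using prefix[of i] prefix[of "i + d"] assms(1)[of d "k + int i"] assms(3) that
    by (simp add: factor_add distrib_left)
  show ?thesis
    unfolding tight_def
  proof (intro allI impI)
    fix i j assume "i \<le> length w" "j \<le> length w"
    then show "\<bar>(real (prefix_count w j) - \<alpha> * real j) - (real (prefix_count w i) - \<alpha> * real i)\<bar> < 1"
      using diff[of i "j - i"] diff[of j "i - j"] by (cases "i \<le> j") (simp_all add: abs_minus_commute)
  qed
qed

theorem theoremA:
  fixes s :: "int \<Rightarrow> letter" and u v :: "letter list"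
  assumes "balanced s"
    and "u \<in> language s" and "v \<in> language s"
    and "u <\<^sub>r v"
  shows "mu_q u $ 1 $ 2 \<prec> mu_q v $ 1 $ 2"
proof -
  have len: "length u \<le> length v"
    using assms(4) by (auto simp: radix_less_iff)
  \<comment> \<open>The bound is the larger of the two lengths, so one slope serves both
    words.\<close>
  obtain \<alpha> where \<alpha>: "\<alpha> \<notin> \<rat>" "0 < \<alpha>" "\<alpha> < 1"
    and slope: "\<And>k n. n \<le> length v \<Longrightarrow> \<bar>real (count_list (factor s k n) L1) - \<alpha> * real n\<bar> < 1"
    using balanced_slope[OF assms(1), of "length v"] by blast
  have tight: "tight \<alpha> u" "tight \<alpha> v"
    using tight_if_in_language[OF slope] assms(2,3) len by auto
  show ?thesis
  proof (cases "length u = length v")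
    case True
    then have lex: "(u, v) \<in> lexord {(L0, L1)}"
      using assms(4) by (simp add: radix_less_iff)
    then have "u \<noteq> v"
      by (auto simp: lexord_def)
    then show ?thesis
      using tight_pointwise_le[OF \<alpha> True tight tight_lexord_pointwise_le[OF True tight lex]]
      by (simp add: poly_prec_iff)
  next
    case False
    then show ?thesis
      using tight_longer_coeffs_pos[OF \<alpha> tight] len by (simp add: poly_prec_iff)
  qed
qed

end
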